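(* Let $m,n\ge 2$ be integers. The set $\mathcal{R}_0$ of all R$_0$-tensors is open in $\mathbb{R}^{[m,n]}$.
   Context: $\mathbb{R}^{[m,n]}$ is the real vector space (of dimension $n^m$) of real $m$-th order $n$-dimensional tensors $\mathcal{A}=(a_{i_1\cdots i_m})$, $i_j\in[n]=\{1,\dots,n\}$, with the Frobenius norm $\|\mathcal{A}\|=\sqrt{\sum a_{i_1\cdots i_m}^2}$. For $x\in\mathbb{R}^n$, $\mathcal{A}x^{m-1}\in\mathbb{R}^n$ has components $(\mathcal{A}x^{m-1})_i=\sum_{i_2,\dots,i_m=1}^n a_{ii_2\cdots i_m}x_{i_2}\cdots x_{i_m}$, and $\mathcal{A}x^m=\langle x,\mathcal{A}x^{m-1}\rangle$. For $a\in\mathbb{R}^n$, $\mathrm{Sol}(\mathcal{A},a)$ is the solution set of the tensor complementarity problem $\mathrm{TCP}(\mathcal{A},a)$, i.e. the set of $x\in\mathbb{R}^n$ with $x\ge 0$, $\mathcal{A}x^{m-1}+a\ge 0$, $\mathcal{A}x^m+\langle x,a\rangle=0$ (inequalities componentwise). $\mathcal{A}$ is an R$_0$-tensor if $\mathrm{Sol}(\mathcal{A},0)=\{0\}$; $\mathcal{R}_0\subset\mathbb{R}^{[m,n]}$ is the set of all R$_0$-tensors. *)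

theory Defs
  imports "HOL-Analysis.Analysis"
begin

text \<open>
  The type argument \<^typ>\<open>'m\<close> is the set of index positions and \<^typ>\<open>'n\<close> is the index range, so the
  order is \<open>CARD('m)\<close> and the dimension \<open>CARD('n)\<close>; an index tuple \<open>(i\<^sub>1, \<dots>, i\<^sub>m)\<close> is a function
  from positions to indices. Positions are linearly ordered because \<open>i\<^sub>1\<close> plays a special role.
  Every order \<open>m \<ge> 2\<close> is realised, e.g. by the numeral types.
\<close>

type_synonym ('m, 'n) tensor = "real ^ ('m \<Rightarrow> 'n)"

text \<open>The library norm on tensors is the Frobenius norm.\<close>

lemma norm_tensor:
  fixes A :: "('m::finite, 'n::finite) tensor"
  shows "norm A = sqrt (\<Sum>s\<in>UNIV. (A $ s)\<^sup>2)"
  by (simp add: norm_vec_def L2_set_def)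

lemma dim_tensor:
  "DIM(('m::finite, 'n::finite) tensor) = CARD('n) ^ CARD('m)"
  by (simp add: card_fun)

definition first_pos :: "'m::{finite,linorder}" where
  "first_pos = Min UNIV"

text \<open>The vector \<open>A x\<^bsup>m-1\<^esup>\<close>: component \<open>i\<close> sums over all index tuples with \<open>i\<^sub>1 = i\<close>.\<close>

definition tensor_apply ::
  "('m::{finite,linorder}, 'n::finite) tensor \<Rightarrow> real ^ 'n \<Rightarrow> real ^ 'n" where
  "tensor_apply A x =
    (\<chi> i. \<Sum>s | s first_pos = i. A $ s * (\<Prod>k\<in>UNIV - {first_pos}. x $ s k))"

text \<open>The scalar \<open>A x\<^bsup>m\<^esup>\<close>.\<close>

definition tensor_form ::
  "('m::{finite,linorder}, 'n::finite) tensor \<Rightarrow> real ^ 'n \<Rightarrow> real" where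
  "tensor_form A x = x \<bullet> tensor_apply A x"

text \<open>The order on \<^typ>\<open>real ^ 'n\<close> is the componentwise one.\<close>

definition TCP_Sol ::
  "('m::{finite,linorder}, 'n::finite) tensor \<Rightarrow> real ^ 'n \<Rightarrow> (real ^ 'n) set" where
  "TCP_Sol A a =
    {x. x \<ge> 0 \<and> tensor_apply A x + a \<ge> 0 \<and> tensor_form A x + x \<bullet> a = 0}"

definition R0_tensor :: "('m::{finite,linorder}, 'n::finite) tensor \<Rightarrow> bool" where
  "R0_tensor A \<longleftrightarrow> TCP_Sol A 0 = {0}"

end

theory Submission
  imports Defs
begin

text \<open>
  Homogeneity lets a nonzero solution of the homogeneous problem be rescaled to norm one. The
  complement of the set of \<open>R\<^sub>0\<close>-tensors is therefore the projection, along the compact unit sphere,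
  of the closed set of pairs consisting of a unit vector and a tensor whose homogeneous
  complementarity problem it solves.
\<close>

lemma tensor_apply_scaleR:
  fixes A :: "('m::{finite,linorder}, 'n::finite) tensor"
  shows "tensor_apply A (c *\<^sub>R x) = c ^ (CARD('m) - 1) *\<^sub>R tensor_apply A x"
  by (simp add: vec_eq_iff tensor_apply_def prod.distrib sum_distrib_left mult.left_commute)

text \<open>The bound makes the exponent \<open>CARD('m) - 1\<close> positive; in order one the
  product is empty and the value does not depend on \<open>x\<close>.\<close>

lemma tensor_apply_zero:
  fixes A :: "('m::{finite,linorder}, 'n::finite) tensor"
  assumes "CARD('m) \<ge> 2"
  shows "tensor_apply A 0 = 0"
  using tensor_apply_scaleR[of A 0 0] assms by (simp add: power_0_left)

text \<open>Both inequalities and the equation are homogeneous, so each is only multiplied by a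
  nonnegative power of \<open>c\<close>.\<close>

lemma TCP_Sol_zero_scaleR:
  assumes "x \<in> TCP_Sol A 0" and "c \<ge> 0"
  shows "c *\<^sub>R x \<in> TCP_Sol A 0"
  using assms
  by (simp add: TCP_Sol_def tensor_form_def tensor_apply_scaleR less_eq_vec_def)

lemma not_R0_tensor_iff:
  fixes A :: "('m::{finite,linorder}, 'n::finite) tensor"
  assumes "CARD('m) \<ge> 2"
  shows "\<not> R0_tensor A \<longleftrightarrow> (\<exists>x\<in>sphere 0 1. x \<in> TCP_Sol A 0)"
proof
  assume "\<not> R0_tensor A"
  \<comment> \<open>Hence \<open>R0_tensor\<close> can fail only through a nonzero solution.\<close>
  moreover have "0 \<in> TCP_Sol A 0"
    by (simp add: TCP_Sol_def tensor_form_def tensor_apply_zero[OF assms])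
  ultimately obtain x where x: "x \<in> TCP_Sol A 0" "x \<noteq> 0"
    unfolding R0_tensor_def by blast
  then have "inverse (norm x) *\<^sub>R x \<in> TCP_Sol A 0"
    by (intro TCP_Sol_zero_scaleR) simp_all
  moreover have "inverse (norm x) *\<^sub>R x \<in> sphere 0 1"
    using x by simp
  ultimately show "\<exists>x\<in>sphere 0 1. x \<in> TCP_Sol A 0"
    by blast
next
  assume "\<exists>x\<in>sphere 0 1. x \<in> TCP_Sol A 0"
  then show "\<not> R0_tensor A"
    unfolding R0_tensor_def by force
qed

text \<open>The conditions are weak inequalities and an equation between polynomials in the entries
  of \<open>x\<close> and \<open>A\<close> jointly.\<close>

lemma closed_TCP_Sol_graph:
  "closed {(x, A :: ('m::{finite,linorder}, 'n::finite) tensor). x \<in> TCP_Sol A a}"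
  unfolding TCP_Sol_def tensor_form_def tensor_apply_def inner_vec_def less_eq_vec_def case_prod_beta
  by (auto intro!: closed_Collect_conj closed_Collect_all closed_Collect_le closed_Collect_eq
      continuous_intros)

theorem proposition3p1:
  assumes "CARD('m::{finite,linorder}) \<ge> 2"
    and "CARD('n::finite) \<ge> 2"
  shows "open {A :: ('m, 'n) tensor. R0_tensor A}"
proof -
  have "closed {A :: ('m, 'n) tensor. \<exists>x. x \<in> sphere 0 1 \<and>
      (x, A) \<in> {(x, A). x \<in> TCP_Sol A 0}}"
    \<comment> \<open>By compactness, unit solutions along a convergent sequence of tensors
      accumulate at a unit solution for the limit.\<close>
    by (intro closed_compact_projection compact_sphere closed_TCP_Sol_graph)
  moreover have "{A :: ('m, 'n) tensor. \<exists>x. x \<in> sphere 0 1 \<and>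
      (x, A) \<in> {(x, A). x \<in> TCP_Sol A 0}} = - {A. R0_tensor A}"
    using not_R0_tensor_iff[OF assms(1)] by blast
  ultimately show ?thesis
    by (simp add: closed_def)
qed

end
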